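(* Let $\upsilon\ge1$ be an integer, $q>-1$ and $p$ real, $s\ge0$ an integer with $s<\frac{p-1}{2}$, and $t,w>0$. Then $${}_KN_{s;\upsilon}^{(p,q)}(t,w)=\frac{\Gamma(p-s)}{\Gamma(p-2s)}\,w^{-q}\left(t(1-D_w^{-\upsilon})\right)^s\,{}_1F_1\!\left(-s,\,p-2s;\,\frac{1}{t(1-D_w^{-\upsilon})}\right)\left\{\frac{w^q}{\Gamma(q+1)}\right\}.$$
   Context: $(a)_n$ is the Pochhammer symbol. The first set of finite bivariate biorthogonal N-Konhauser polynomials is $${}_KN_{s;\upsilon}^{(p,q)}(t,w)=\Gamma(p-s)\sum_{k=0}^{s}\sum_{m=0}^{s-k}\frac{(-s)_{k+m}\,t^{s-k}w^{\upsilon m}}{\Gamma(p-2s+k)\,\Gamma(q+1+\upsilon m)\,k!\,m!}.$$ $D_w^{-1}f(w)=\int_0^wf(\xi)\,d\xi$ and $D_w^{-\upsilon}$ is its $\upsilon$-fold iterate. ${}_1F_1(a,c;x)=\sum_{k\ge0}\frac{(a)_k}{(c)_k}\frac{x^k}{k!}$, which terminates for $a=-s$; accordingly the operator $\left(t(1-D_w^{-\upsilon})\right)^s{}_1F_1\!\left(-s,p-2s;\frac{1}{t(1-D_w^{-\upsilon})}\right)$ means the polynomial operator $\sum_{k=0}^{s}\frac{(-s)_k}{k!\,(p-2s)_k}\left(t(1-D_w^{-\upsilon})\right)^{s-k}$, applied to the function of $w$ in braces. *)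

theory Defs
  imports "HOL-Analysis.Analysis"
begin

definition N_Konhauser :: "nat \<Rightarrow> nat \<Rightarrow> real \<Rightarrow> real \<Rightarrow> real \<Rightarrow> real \<Rightarrow> real" where
  "N_Konhauser s \<upsilon> p q t w =
     Gamma (p - real s) *
       (\<Sum>k=0..s. \<Sum>m=0..s-k.
          pochhammer (- real s) (k + m) * t ^ (s - k) * w ^ (\<upsilon> * m) /
          (Gamma (p - 2 * real s + real k) * Gamma (q + 1 + real (\<upsilon> * m)) * fact k * fact m))"

text \<open>
  The antiderivative vanishing at 0, only meant for arguments \<open>w \<ge> 0\<close>. The gauge integral
  covers integrands such as \<open>\<lambda>x. x powr q\<close> with \<open>-1 < q < 0\<close>, which are unbounded near 0.
\<close>
definition D_inv :: "(real \<Rightarrow> real) \<Rightarrow> real \<Rightarrow> real" where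
  "D_inv f = (\<lambda>w. integral {0..w} f)"

definition t_one_minus_D_inv :: "real \<Rightarrow> nat \<Rightarrow> (real \<Rightarrow> real) \<Rightarrow> real \<Rightarrow> real" where
  "t_one_minus_D_inv t \<upsilon> f = (\<lambda>w. t * (f w - (D_inv ^^ \<upsilon>) f w))"

text \<open>
  The operator \<open>T\<^sup>s \<cdot> \<^sub>1F\<^sub>1(-s, c; 1/T)\<close>: the series terminates at \<open>k = s\<close>, and \<open>T\<^sup>s \<cdot> T\<^sup>-\<^sup>k\<close> is
  read as the iterate of order \<open>s - k\<close>, so that no inverse of \<open>T\<close> is involved.
\<close>
definition terminating_1F1_op ::
    "nat \<Rightarrow> real \<Rightarrow> ((real \<Rightarrow> real) \<Rightarrow> real \<Rightarrow> real) \<Rightarrow> (real \<Rightarrow> real) \<Rightarrow> real \<Rightarrow> real" where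
  "terminating_1F1_op s c T f =
     (\<lambda>w. \<Sum>k=0..s. pochhammer (- real s) k / (fact k * pochhammer c k) * (T ^^ (s - k)) f w)"

end

theory Submission imports Defs begin

text \<open>
  The functions \<open>w\<^sup>a / \<Gamma>(a + 1)\<close> are shifted by integration: the antiderivative
  vanishing at 0 sends the one of exponent \<open>a\<close> to the one of exponent \<open>a + 1\<close>
  (\<open>D_inv_sum_kernel\<close>). Hence \<open>D\<^sub>w\<^sup>-\<^sup>\<upsilon>\<close> raises the exponent by \<open>\<upsilon>\<close>, and the
  binomial theorem for \<open>(1 - D\<^sub>w\<^sup>-\<^sup>\<upsilon>)\<^sup>n\<close> gives the image of the function of exponent \<open>q\<close>
  under \<open>(t(1 - D\<^sub>w\<^sup>-\<^sup>\<upsilon>))\<^sup>n\<close> as an alternating binomial sum of the functions of exponents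
  \<open>q + \<upsilon>m\<close> (\<open>t_one_minus_D_inv_funpow_kernel\<close>). For \<open>n = s - k\<close> the coefficient
  \<open>(-1)\<^sup>m (s - k choose m)\<close> equals \<open>(k - s)\<^sub>m / m!\<close>, which the factor \<open>(-s)\<^sub>k\<close> of the
  hypergeometric series completes to \<open>(-s)\<^sub>k\<^sub>+\<^sub>m / m!\<close>. In the same way \<open>\<Gamma>(p - 2s)\<close>
  completes \<open>(p - 2s)\<^sub>k\<close> to \<open>\<Gamma>(p - 2s + k)\<close>, and \<open>w\<^sup>-\<^sup>q\<close> leaves the integer power
  \<open>w\<^sup>\<upsilon>\<^sup>m\<close>; so the two double sums agree term by term.

  All function identities hold for positive arguments only. That is enough to iterate the
  operators, because the integral ignores the value of the integrand at 0.
\<close>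

definition power_kernel :: "real \<Rightarrow> real \<Rightarrow> real" where
  "power_kernel a x = x powr a / Gamma (a + 1)"

lemma has_integral_power_kernel:
  assumes "a > -1" and "x \<ge> 0"
  shows "(power_kernel a has_integral power_kernel (a + 1) x) {0..x}"
proof -
  have "((\<lambda>y. y powr a / Gamma (a + 1)) has_integral
      (x powr (a + 1) / (a + 1)) / Gamma (a + 1)) {0..x}"
    by (intro has_integral_divide has_integral_powr_from_0 assms)
  moreover have "Gamma (a + 1 + 1) = (a + 1) * Gamma (a + 1)"
    using assms by (intro Gamma_plus1) (auto simp: nonpos_Ints_def)
  ultimately show ?thesis
    by (simp add: power_kernel_def[abs_def] mult.commute)
qed

text \<open>
  Linearity is needed for finite combinations of the kernels only, which spares
  integrability conditions. Since the hypothesis and the conclusion have the same shape and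
  leave out the argument 0, the statement can be iterated.
\<close>
lemma D_inv_sum_kernel:
  assumes "finite A" and "\<And>m. m \<in> A \<Longrightarrow> b m > -1"
    and f: "\<And>y. y > 0 \<Longrightarrow> f y = (\<Sum>m\<in>A. c m * power_kernel (b m) y)"
    and "x > 0"
  shows "D_inv f x = (\<Sum>m\<in>A. c m * power_kernel (b m + 1) x)"
proof -
  have "((\<lambda>y. \<Sum>m\<in>A. c m * power_kernel (b m) y) has_integral
      (\<Sum>m\<in>A. c m * power_kernel (b m + 1) x)) {0..x}"
    using assms by (intro has_integral_sum has_integral_mult_right has_integral_power_kernel) auto
  then have "(f has_integral (\<Sum>m\<in>A. c m * power_kernel (b m + 1) x)) {0..x}"
    by (rule has_integral_spike_finite[of "{0}", rotated 2]) (auto simp: f)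
  then show ?thesis
    by (simp add: D_inv_def integral_unique)
qed

lemma D_inv_funpow_sum_kernel:
  assumes "finite A" and b: "\<And>m. m \<in> A \<Longrightarrow> b m > -1"
    and f: "\<And>y. y > 0 \<Longrightarrow> f y = (\<Sum>m\<in>A. c m * power_kernel (b m) y)"
    and "x > 0"
  shows "(D_inv ^^ j) f x = (\<Sum>m\<in>A. c m * power_kernel (b m + real j) x)"
  using \<open>x > 0\<close>
proof (induction j arbitrary: x)
  case 0
  then show ?case by (simp add: f)
next
  case (Suc j)
  have "D_inv ((D_inv ^^ j) f) x = (\<Sum>m\<in>A. c m * power_kernel (b m + real j + 1) x)"
    using assms(1) Suc by (intro D_inv_sum_kernel) (auto dest!: b)
  then show ?case by (simp add: add_ac)
qed

text \<open>
  Pascal's rule in the form that multiplies an alternating binomial sum by \<open>1 - S\<close>,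
  where \<open>S\<close> shifts the index of the sequence \<open>g\<close>.
\<close>
lemma alternating_binomial_sum_Suc:
  fixes g :: "nat \<Rightarrow> 'a :: comm_ring_1"
  shows "(\<Sum>m\<le>n. (-1) ^ m * of_nat (n choose m) * g m) -
      (\<Sum>m\<le>n. (-1) ^ m * of_nat (n choose m) * g (Suc m)) =
    (\<Sum>m\<le>Suc n. (-1) ^ m * of_nat (Suc n choose m) * g m)"
proof -
  have "(\<Sum>m\<le>Suc n. (-1) ^ m * of_nat (Suc n choose m) * g m) =
      g 0 + (\<Sum>m\<le>n. (-1) ^ Suc m * of_nat (n choose Suc m) * g (Suc m))
        - (\<Sum>m\<le>n. (-1) ^ m * of_nat (n choose m) * g (Suc m))"
    by (subst sum.atMost_Suc_shift) (simp add: algebra_simps sum.distrib sum_subtractf sum_negf)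
  also have "g 0 + (\<Sum>m\<le>n. (-1) ^ Suc m * of_nat (n choose Suc m) * g (Suc m)) =
      (\<Sum>m\<le>Suc n. (-1) ^ m * of_nat (n choose m) * g m)"
    by (subst sum.atMost_Suc_shift) simp
  finally show ?thesis by (simp add: binomial_eq_0)
qed

lemma t_one_minus_D_inv_funpow_kernel:
  assumes "a > -1" and "x > 0"
  shows "(t_one_minus_D_inv t \<upsilon> ^^ n) (power_kernel a) x =
    t ^ n * (\<Sum>m\<le>n. (-1) ^ m * real (n choose m) * power_kernel (a + real (\<upsilon> * m)) x)"
  using \<open>x > 0\<close>
proof (induction n arbitrary: x)
  case 0
  then show ?case by simp
next
  case (Suc n)
  define f where "f = (t_one_minus_D_inv t \<upsilon> ^^ n) (power_kernel a)"
  define g where "g m = power_kernel (a + real (\<upsilon> * m)) x" for m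
  have f: "f y = (\<Sum>m\<le>n. (t ^ n * ((-1) ^ m * real (n choose m))) *
      power_kernel (a + real (\<upsilon> * m)) y)" if "y > 0" for y
    using Suc.IH[OF that] by (simp add: f_def sum_distrib_left mult.assoc)
  have "a + real (\<upsilon> * m) > -1" for m
    using \<open>a > -1\<close> by (smt (verit) of_nat_0_le_iff)
  then have "(D_inv ^^ \<upsilon>) f x = (\<Sum>m\<le>n. (t ^ n * ((-1) ^ m * real (n choose m))) *
      power_kernel (a + real (\<upsilon> * m) + real \<upsilon>) x)"
    using f Suc.prems by (intro D_inv_funpow_sum_kernel) auto
  also have "\<dots> = t ^ n * (\<Sum>m\<le>n. (-1) ^ m * real (n choose m) * g (Suc m))"
    by (simp add: g_def sum_distrib_left algebra_simps)
  finally have "(D_inv ^^ \<upsilon>) f x = \<dots>" .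
  moreover have "f x = t ^ n * (\<Sum>m\<le>n. (-1) ^ m * real (n choose m) * g m)"
    using f[OF Suc.prems] by (simp add: g_def sum_distrib_left mult.assoc)
  ultimately have "t_one_minus_D_inv t \<upsilon> f x = t ^ Suc n *
      ((\<Sum>m\<le>n. (-1) ^ m * real (n choose m) * g m) -
       (\<Sum>m\<le>n. (-1) ^ m * real (n choose m) * g (Suc m)))"
    by (simp add: t_one_minus_D_inv_def right_diff_distrib)
  then show ?case
    unfolding alternating_binomial_sum_Suc by (simp add: f_def g_def)
qed

lemma pochhammer_minus_add:
  assumes "k \<le> s"
  shows "pochhammer (- real s) k * ((-1) ^ m * real (s - k choose m)) =
    pochhammer (- real s) (k + m) / fact m"
proof -
  have "(-1) ^ m * real (s - k choose m) = pochhammer (- real s + real k) m / fact m"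
    using assms by (simp add: binomial_gbinomial gbinomial_pochhammer of_nat_diff)
  then show ?thesis
    by (simp add: pochhammer_product')
qed

theorem theorem25:
  fixes \<upsilon> s :: nat and p q t w :: real
  assumes "\<upsilon> \<ge> 1" and "q > -1" and "real s < (p - 1) / 2" and "t > 0" and "w > 0"
  shows "N_Konhauser s \<upsilon> p q t w =
    Gamma (p - real s) / Gamma (p - 2 * real s) * w powr (- q) *
      terminating_1F1_op s (p - 2 * real s) (t_one_minus_D_inv t \<upsilon>)
        (\<lambda>x. x powr q / Gamma (q + 1)) w"
proof -
  define c where "c = p - 2 * real s"
  have "c > 0" using assms(3) by (simp add: c_def)
  have Gamma_c: "Gamma (c + real k) = Gamma c * pochhammer c k" for k
  proof -
    have "c \<notin> \<int>\<^sub>\<le>\<^sub>0"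
      using \<open>c > 0\<close> by (auto simp: nonpos_Ints_def)
    moreover have "Gamma c > 0"
      using \<open>c > 0\<close> by (rule Gamma_real_pos)
    ultimately show ?thesis
      by (simp add: pochhammer_Gamma)
  qed
  have kernel: "w powr (- q) * power_kernel (q + real (\<upsilon> * m)) w =
      w ^ (\<upsilon> * m) / Gamma (q + 1 + real (\<upsilon> * m))" for m
  proof -
    have "w powr (- q) * w powr (q + real (\<upsilon> * m)) = w ^ (\<upsilon> * m)"
      using \<open>w > 0\<close> by (simp flip: powr_add powr_realpow)
    then show ?thesis
      by (simp add: power_kernel_def add_ac)
  qed
  have summand: "1 / Gamma c * w powr (- q) *
      (pochhammer (- real s) k / (fact k * pochhammer c k) *
        (t_one_minus_D_inv t \<upsilon> ^^ (s - k)) (power_kernel q) w) =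
      (\<Sum>m=0..s-k. pochhammer (- real s) (k + m) * t ^ (s - k) * w ^ (\<upsilon> * m) /
        (Gamma (c + real k) * Gamma (q + 1 + real (\<upsilon> * m)) * fact k * fact m))"
    (is "?lhs = ?rhs") if "k \<le> s" for k
  proof -
    have "?lhs = (\<Sum>m\<le>s-k. t ^ (s - k) / (Gamma (c + real k) * fact k) *
        (pochhammer (- real s) k * ((-1) ^ m * real (s - k choose m))) *
        (w powr (- q) * power_kernel (q + real (\<upsilon> * m)) w))"
      using \<open>w > 0\<close> \<open>q > -1\<close>
      by (simp add: t_one_minus_D_inv_funpow_kernel Gamma_c sum_distrib_left mult_ac)
    also have "\<dots> = ?rhs"
      unfolding pochhammer_minus_add[OF that] kernel
      by (simp add: atMost_atLeast0 mult_ac)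
    finally show ?thesis .
  qed
  have "Gamma (p - real s) / Gamma c * w powr (- q) *
      terminating_1F1_op s c (t_one_minus_D_inv t \<upsilon>) (power_kernel q) w =
    Gamma (p - real s) * (\<Sum>k=0..s. 1 / Gamma c * w powr (- q) *
      (pochhammer (- real s) k / (fact k * pochhammer c k) *
        (t_one_minus_D_inv t \<upsilon> ^^ (s - k)) (power_kernel q) w))"
    by (simp add: terminating_1F1_op_def sum_distrib_left mult_ac)
  also have "\<dots> = N_Konhauser s \<upsilon> p q t w"
    unfolding N_Konhauser_def c_def[symmetric]
    by (intro arg_cong[of _ _ "\<lambda>S. Gamma (p - real s) * S"] sum.cong refl summand) simp
  finally show ?thesis
    by (simp add: c_def power_kernel_def[abs_def])
qed

end
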